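(* Let $d\ge1$ and let $(X_\ell)_{\ell\in\mathbb Z^d}$ be a centered strictly stationary random field of square integrable, pairwise positively quadrant dependent (PQD) real random variables on a probability space $(\Omega,\mathcal F,\mathbb P)$, with common distribution function $F$, such that $\sum_{\ell\in\mathbb Z^d}\langle X_\ell,X_{0}\rangle$ converges. Let $(z_k)_{k\ge0}$ be a sequence in $\mathbb Z^d$ with maximal local times $(M_n)$. If $\sum_{n\ge1}\frac{M_n}{n^2}<+\infty$, then for each continuity point $s$ of $F$ we have, for a.e. $\omega$, $$\lim_n\frac1n\sum_{k=0}^{n-1}\mathbf 1_{(-\infty,s]}(X_{z_k}(\omega))=F(s).$$ In particular, if $F$ is continuous, then (for a.e. $\omega$) this convergence is uniform over $s$.
   Context: For a sequence $(z_k)_{k\ge0}$ in $\mathbb Z^d$ and $n\ge1$: $N_n(\ell):=\#\{0\le k\le n-1: z_k=\ell\}$ and $M_n:=\max_{\ell}N_n(\ell)$. $\langle X,Y\rangle=\mathbb E[XY]$. Two random variables $X,Y$ are PQD if $\mathbb P(X>x,Y>y)\ge\mathbb P(X>x)\,\mathbb P(Y>y)$ for all $x,y\in\mathbb R$; a family is pairwise PQD if any two of its members are PQD. *)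

theory Defs
  imports "HOL-Probability.Probability"
begin

text \<open>The lattice \<open>\<int>\<^sup>d\<close> is the type \<^typ>\<open>int ^ 'd\<close> with \<open>d = CARD('d) \<ge> 1\<close>.\<close>

definition local_time :: "(nat \<Rightarrow> 'a) \<Rightarrow> nat \<Rightarrow> 'a \<Rightarrow> nat"
  where "local_time z n l = card {k. k < n \<and> z k = l}"

text \<open>The maximum is well defined over an infinite lattice: the values are bounded by \<open>n\<close>,
  so the range is finite.\<close>

definition max_local_time :: "(nat \<Rightarrow> 'a) \<Rightarrow> nat \<Rightarrow> nat"
  where "max_local_time z n = Max (range (local_time z n))"

definition PQD :: "'w measure \<Rightarrow> ('w \<Rightarrow> real) \<Rightarrow> ('w \<Rightarrow> real) \<Rightarrow> bool"
  where "PQD P X Y \<longleftrightarrow>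
    (\<forall>x y. measure P {\<omega> \<in> space P. X \<omega> > x \<and> Y \<omega> > y}
        \<ge> measure P {\<omega> \<in> space P. X \<omega> > x} * measure P {\<omega> \<in> space P. Y \<omega> > y})"

definition pairwise_PQD :: "'w measure \<Rightarrow> ('i \<Rightarrow> 'w \<Rightarrow> real) \<Rightarrow> bool"
  where "pairwise_PQD P X \<longleftrightarrow> (\<forall>i j. i \<noteq> j \<longrightarrow> PQD P (X i) (X j))"

text \<open>Strict stationarity: all finite-dimensional distributions are invariant under translations
  of the index group.\<close>

definition strictly_stationary :: "'w measure \<Rightarrow> ('i :: ab_group_add \<Rightarrow> 'w \<Rightarrow> real) \<Rightarrow> bool"
  where "strictly_stationary P X \<longleftrightarrow>
    (\<forall>J h. finite J \<longrightarrow>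
      distr P (Pi\<^sub>M J (\<lambda>_. borel)) (\<lambda>\<omega>. \<lambda>l\<in>J. X (l + h) \<omega>) =
      distr P (Pi\<^sub>M J (\<lambda>_. borel)) (\<lambda>\<omega>. \<lambda>l\<in>J. X l \<omega>))"

definition empirical_cdf :: "('i \<Rightarrow> 'w \<Rightarrow> real) \<Rightarrow> (nat \<Rightarrow> 'i) \<Rightarrow> 'w \<Rightarrow> nat \<Rightarrow> real \<Rightarrow> real"
  where "empirical_cdf X z \<omega> n s = (1 / real n) * (\<Sum>k<n. indicator {..s} (X (z k) \<omega>))"

end

theory Submission
  imports Defs
begin

text \<open>Fix a Lipschitz nondecreasing ramp \<open>f\<close> with values in \<open>[0, 1]\<close> and let
  \<open>S\<^sub>n\<close> be the centered partial sums of \<open>f (X\<^bsub>z k\<^esub>)\<close>. Positive quadrant dependence bounds the covariances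
  of \<open>f (X\<^sub>l)\<close> by a multiple of those of \<open>X\<^sub>l\<close>, so \<open>E S\<^sub>n\<^sup>2 \<le> K n M\<^sub>n\<close> and hence
  \<open>\<Sum> S\<^sub>n\<^sup>2 / n\<^sup>3 < \<infinity>\<close> almost surely. As the increments of \<open>S\<^sub>n\<close> are bounded by \<open>1\<close>,
  a single large value of \<open>|S\<^sub>n| / n\<close> persists over a block of length proportional to \<open>n\<close>;
  this forces \<open>S\<^sub>n / n \<longlongrightarrow> 0\<close>. Indicators of half-lines are squeezed between two ramps, and
  uniformity follows from monotonicity as in Polya's theorem.\<close>

section \<open>Positive quadrant dependence and covariance inequalities\<close>

text \<open>Monotonicity makes the set upward closed and continuity makes it open, so a nontrivial
  one cannot contain its infimum. Openness matters because \<open>PQD\<close> speaks of strict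
  inequalities, that is, of open rays.\<close>

lemma upper_level_set_cases:
  fixes f :: "real \<Rightarrow> real"
  assumes "mono f" "continuous_on UNIV f"
  obtains "{t. u < f t} = {}" | "{t. u < f t} = UNIV" | a where "{t. u < f t} = {a<..}"
proof -
  let ?A = "{t. u < f t}"
  have op: "open ?A"
    using assms(2) by (intro open_Collect_less) auto
  have up: "y \<in> ?A" if "x \<in> ?A" "x \<le> y" for x y
    using that monoD[OF assms(1), of x y] by auto
  show thesis
  proof (cases "?A = {} \<or> ?A = UNIV")
    case False
    then obtain b where b: "b \<notin> ?A" and ne: "?A \<noteq> {}" by auto
    have bdd: "bdd_below ?A"
    proof (rule bdd_belowI)
      fix x assume "x \<in> ?A"
      then show "b \<le> x" using up b by (meson linorder_le_cases)
    qed
    have "Inf ?A \<notin> ?A"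
    proof
      assume "Inf ?A \<in> ?A"
      then obtain e where e: "e > 0" "ball (Inf ?A) e \<subseteq> ?A"
        using op by (meson openE)
      have "Inf ?A - e/2 \<in> ball (Inf ?A) e"
        using e(1) by (simp add: dist_real_def)
      then have "Inf ?A - e/2 \<in> ?A" using e(2) by blast
      from cInf_lower[OF this bdd] e(1) show False by simp
    qed
    then have "x \<in> ?A \<longleftrightarrow> Inf ?A < x" for x
      using cInf_lower[OF _ bdd, of x] cInf_less_iff[OF ne bdd, of x] up
      by (metis less_imp_le order_le_less)
    then have "?A = {Inf ?A<..}" by blast
    then show thesis by (rule that(3))
  qed (use that in auto)
qed

text \<open>The event that \<open>f X\<close> exceeds a level says that \<open>X\<close> lies in an
  open ray, in the empty set or in the whole line. For two rays the inequality is the hypothesis; if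
  one of the sets is empty or full, it is an equality.\<close>

lemma (in prob_space) PQD_comp:
  assumes "PQD M X Y"
    and f: "mono f" "continuous_on UNIV f" and g: "mono g" "continuous_on UNIV g"
  shows "PQD M (\<lambda>\<omega>. f (X \<omega>)) (\<lambda>\<omega>. g (Y \<omega>))"
  unfolding PQD_def
proof (intro allI)
  fix x y
  let ?Q = "\<lambda>A B. measure M {\<omega> \<in> space M. X \<omega> \<in> A} * measure M {\<omega> \<in> space M. Y \<omega> \<in> B}
     \<le> measure M {\<omega> \<in> space M. X \<omega> \<in> A \<and> Y \<omega> \<in> B}"
  have rays: "?Q {a<..} {b<..}" for a b
    using assms(1) unfolding PQD_def by simp
  have empty: "?Q {} B" "?Q A {}" for A B by simp_all
  have univ: "?Q UNIV B" "?Q A UNIV" for A B by (simp_all add: prob_space)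
  have "?Q {t. x < f t} {t. y < g t}"
  proof (rule upper_level_set_cases[OF f, of x]; rule upper_level_set_cases[OF g, of y])
  qed (simp_all only: rays empty univ)
  then show "measure M {\<omega> \<in> space M. x < f (X \<omega>)} * measure M {\<omega> \<in> space M. y < g (Y \<omega>)}
     \<le> measure M {\<omega> \<in> space M. x < f (X \<omega>) \<and> y < g (Y \<omega>)}"
    by simp
qed

text \<open>The layer-cake identity for a single value, applied below with
  \<open>c = X \<omega>\<close> and \<open>c = Y \<omega>\<close>.\<close>

lemma nn_integral_indicator_ray:
  "0 \<le> c \<Longrightarrow> (\<integral>\<^sup>+x. indicator {x. 0 \<le> x \<and> x < c} x \<partial>lborel) = ennreal c" for c :: real
proof -
  assume "0 \<le> c"
  have "{x::real. 0 \<le> x \<and> x < c} = {0..<c}" by auto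
  then show ?thesis using \<open>0 \<le> c\<close> by simp
qed

text \<open>Hoeffding's formula: for nonnegative variables, E X is the integral of P(X > x) over x
  \<ge> 0, and E XY is the double integral of P(X > x, Y > y). \<open>PQD\<close> compares the
  integrands pointwise. Working with nonnegative integrals reduces every exchange of integrals to
  Tonelli.\<close>

lemma (in prob_space) PQD_expectation_mult_nonneg:
  assumes [measurable]: "X \<in> borel_measurable M" "Y \<in> borel_measurable M"
    and "integrable M X" "integrable M Y" "integrable M (\<lambda>\<omega>. X \<omega> * Y \<omega>)"
    and nn: "\<And>\<omega>. 0 \<le> X \<omega>" "\<And>\<omega>. 0 \<le> Y \<omega>"
    and pqd: "PQD M X Y"
  shows "expectation X * expectation Y \<le> expectation (\<lambda>\<omega>. X \<omega> * Y \<omega>)"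
proof -
  interpret L: pair_sigma_finite M lborel
    by (intro pair_sigma_finite.intro sigma_finite_measure_axioms sigma_finite_lborel)
  define a :: "'a \<Rightarrow> real \<Rightarrow> ennreal" where "a \<omega> x = (if 0 \<le> x \<and> x < X \<omega> then 1 else 0)" for \<omega> x
  define b :: "'a \<Rightarrow> real \<Rightarrow> ennreal" where "b \<omega> y = (if 0 \<le> y \<and> y < Y \<omega> then 1 else 0)" for \<omega> y
  have [measurable]: "case_prod a \<in> borel_measurable (M \<Otimes>\<^sub>M lborel)"
    "case_prod b \<in> borel_measurable (M \<Otimes>\<^sub>M lborel)"
    unfolding a_def b_def by measurable
  have inta: "(\<integral>\<^sup>+x. a \<omega> x \<partial>lborel) = ennreal (X \<omega>)" for \<omega>
    using nn_integral_indicator_ray[of "X \<omega>"] nn by (simp add: a_def indicator_def of_bool_def)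
  have intb: "(\<integral>\<^sup>+x. b \<omega> x \<partial>lborel) = ennreal (Y \<omega>)" for \<omega>
    using nn_integral_indicator_ray[of "Y \<omega>"] nn by (simp add: b_def indicator_def of_bool_def)
  \<comment> \<open>At nonnegative levels the three integrals are the probabilities in
    \<open>PQD\<close>; at a negative level both sides vanish.\<close>
  have key: "(\<integral>\<^sup>+\<omega>. a \<omega> x \<partial>M) * (\<integral>\<^sup>+\<omega>. b \<omega> y \<partial>M) \<le> (\<integral>\<^sup>+\<omega>. a \<omega> x * b \<omega> y \<partial>M)" for x y
  proof (cases "0 \<le> x \<and> 0 \<le> y")
    case True
    have "(\<integral>\<^sup>+\<omega>. a \<omega> x \<partial>M) = (\<integral>\<^sup>+\<omega>. indicator {\<omega> \<in> space M. x < X \<omega>} \<omega> \<partial>M)"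
      using True by (intro nn_integral_cong) (auto simp: a_def)
    moreover have "(\<integral>\<^sup>+\<omega>. b \<omega> y \<partial>M) = (\<integral>\<^sup>+\<omega>. indicator {\<omega> \<in> space M. y < Y \<omega>} \<omega> \<partial>M)"
      using True by (intro nn_integral_cong) (auto simp: b_def)
    moreover have "(\<integral>\<^sup>+\<omega>. a \<omega> x * b \<omega> y \<partial>M)
        = (\<integral>\<^sup>+\<omega>. indicator {\<omega> \<in> space M. x < X \<omega> \<and> y < Y \<omega>} \<omega> \<partial>M)"
      using True by (intro nn_integral_cong) (auto simp: a_def b_def)
    ultimately show ?thesis
      using pqd by (simp add: emeasure_eq_measure PQD_def flip: ennreal_mult)
  next
    case False
    then show ?thesis by (auto simp: a_def b_def)
  qed
  have "ennreal (expectation X) * ennreal (expectation Y) = (\<integral>\<^sup>+\<omega>. X \<omega> \<partial>M) * (\<integral>\<^sup>+\<omega>. Y \<omega> \<partial>M)"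
    using assms by (simp add: nn_integral_eq_integral)
  also have "\<dots> = (\<integral>\<^sup>+x. \<integral>\<^sup>+\<omega>. a \<omega> x \<partial>M \<partial>lborel) * (\<integral>\<^sup>+y. \<integral>\<^sup>+\<omega>. b \<omega> y \<partial>M \<partial>lborel)"
    unfolding inta[symmetric] intb[symmetric] by (subst (1 2) L.Fubini') simp_all
  also have "\<dots> = (\<integral>\<^sup>+x. \<integral>\<^sup>+y. (\<integral>\<^sup>+\<omega>. a \<omega> x \<partial>M) * (\<integral>\<^sup>+\<omega>. b \<omega> y \<partial>M) \<partial>lborel \<partial>lborel)"
    by (simp add: nn_integral_cmult nn_integral_multc)
  also have "\<dots> \<le> (\<integral>\<^sup>+x. \<integral>\<^sup>+y. \<integral>\<^sup>+\<omega>. a \<omega> x * b \<omega> y \<partial>M \<partial>lborel \<partial>lborel)"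
    by (intro nn_integral_mono key)
  also have "\<dots> = (\<integral>\<^sup>+x. \<integral>\<^sup>+\<omega>. \<integral>\<^sup>+y. a \<omega> x * b \<omega> y \<partial>lborel \<partial>M \<partial>lborel)"
    by (subst L.Fubini') simp_all
  also have "\<dots> = (\<integral>\<^sup>+\<omega>. \<integral>\<^sup>+x. \<integral>\<^sup>+y. a \<omega> x * b \<omega> y \<partial>lborel \<partial>lborel \<partial>M)"
    by (subst L.Fubini'[symmetric]) simp_all
  also have "\<dots> = (\<integral>\<^sup>+\<omega>. ennreal (X \<omega> * Y \<omega>) \<partial>M)"
  proof (rule nn_integral_cong)
    fix \<omega> assume [measurable]: "\<omega> \<in> space M"
    have "(\<integral>\<^sup>+x. \<integral>\<^sup>+y. a \<omega> x * b \<omega> y \<partial>lborel \<partial>lborel) = (\<integral>\<^sup>+x. a \<omega> x * (\<integral>\<^sup>+y. b \<omega> y \<partial>lborel) \<partial>lborel)"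
      by (simp add: nn_integral_cmult)
    then show "(\<integral>\<^sup>+x. \<integral>\<^sup>+y. a \<omega> x * b \<omega> y \<partial>lborel \<partial>lborel) = ennreal (X \<omega> * Y \<omega>)"
      using nn by (simp add: nn_integral_multc inta intb ennreal_mult)
  qed
  also have "\<dots> = ennreal (expectation (\<lambda>\<omega>. X \<omega> * Y \<omega>))"
    using assms by (intro nn_integral_eq_integral) auto
  finally show ?thesis
    using nn by (simp flip: ennreal_mult)
qed

lemma integrable_mult_of_squares:
  fixes X Y :: "'a \<Rightarrow> real"
  assumes [measurable]: "X \<in> borel_measurable M" "Y \<in> borel_measurable M"
    and "integrable M (\<lambda>\<omega>. (X \<omega>)\<^sup>2)" "integrable M (\<lambda>\<omega>. (Y \<omega>)\<^sup>2)"
  shows "integrable M (\<lambda>\<omega>. X \<omega> * Y \<omega>)"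
proof (rule Bochner_Integration.integrable_bound)
  show "integrable M (\<lambda>\<omega>. (X \<omega>)\<^sup>2 + (Y \<omega>)\<^sup>2)" using assms by simp
  show "AE \<omega> in M. norm (X \<omega> * Y \<omega>) \<le> norm ((X \<omega>)\<^sup>2 + (Y \<omega>)\<^sup>2)"
  proof (rule AE_I2)
    fix \<omega>
    have "2 * \<bar>X \<omega>\<bar> * \<bar>Y \<omega>\<bar> \<le> (X \<omega>)\<^sup>2 + (Y \<omega>)\<^sup>2"
      using sum_squares_bound[of "\<bar>X \<omega>\<bar>" "\<bar>Y \<omega>\<bar>"] by simp
    moreover have "0 \<le> \<bar>X \<omega>\<bar> * \<bar>Y \<omega>\<bar>" by simp
    ultimately show "norm (X \<omega> * Y \<omega>) \<le> norm ((X \<omega>)\<^sup>2 + (Y \<omega>)\<^sup>2)"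
      unfolding real_norm_def abs_mult by linarith
  qed
qed simp

text \<open>Truncating from below at -n and adding n gives nonnegative variables that are still
  \<open>PQD\<close>, since both operations are continuous and nondecreasing. Constant shifts do not
  change a covariance, and dominated convergence removes the truncation.\<close>

lemma (in prob_space) PQD_expectation_mult:
  assumes [measurable]: "X \<in> borel_measurable M" "Y \<in> borel_measurable M"
    and sq: "integrable M (\<lambda>\<omega>. (X \<omega>)\<^sup>2)" "integrable M (\<lambda>\<omega>. (Y \<omega>)\<^sup>2)"
    and pqd: "PQD M X Y"
  shows "expectation X * expectation Y \<le> expectation (\<lambda>\<omega>. X \<omega> * Y \<omega>)"
proof -
  define T :: "nat \<Rightarrow> real \<Rightarrow> real" where "T n x = max x (- real n)" for n x
  have [measurable]: "T n \<in> borel_measurable borel" for n unfolding T_def by measurable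
  have T_le: "\<bar>T n x\<bar> \<le> \<bar>x\<bar>" for n x by (auto simp: T_def)
  have T_mono: "mono (\<lambda>x. T n x + real n)" for n by (auto simp: T_def mono_def)
  have T_cont: "continuous_on UNIV (\<lambda>x. T n x + real n)" for n
    unfolding T_def by (intro continuous_intros)
  have T_nonneg: "0 \<le> T n x + real n" for n x by (simp add: T_def)
  have T_lim: "(\<lambda>n. T n x) \<longlonglongrightarrow> x" for x
  proof (rule tendsto_eventually)
    obtain N where "- x \<le> real N" using real_arch_simple by blast
    then show "\<forall>\<^sub>F n in sequentially. T n x = x"
      unfolding eventually_sequentially T_def by (intro exI[of _ N]) auto
  qed
  have intX: "integrable M X" and intY: "integrable M Y"
    using sq by (auto intro: square_integrable_imp_integrable)
  have intXY: "integrable M (\<lambda>\<omega>. X \<omega> * Y \<omega>)"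
    using sq by (intro integrable_mult_of_squares) auto
  have iT: "integrable M (\<lambda>\<omega>. T n (X \<omega>))" "integrable M (\<lambda>\<omega>. T n (Y \<omega>))" for n
    using T_le by (auto intro: Bochner_Integration.integrable_bound[OF intX]
      Bochner_Integration.integrable_bound[OF intY])
  have TT_le: "\<bar>T n x * T n y\<bar> \<le> \<bar>x * y\<bar>" for n x y
    by (simp add: abs_mult mult_mono T_le)
  have iTT: "integrable M (\<lambda>\<omega>. T n (X \<omega>) * T n (Y \<omega>))" for n
    using TT_le by (auto intro!: Bochner_Integration.integrable_bound[OF intXY])
  have step: "expectation (\<lambda>\<omega>. T n (X \<omega>)) * expectation (\<lambda>\<omega>. T n (Y \<omega>))
      \<le> expectation (\<lambda>\<omega>. T n (X \<omega>) * T n (Y \<omega>))" for n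
  proof -
    let ?S = "\<lambda>x. T n x + real n"
    have expand: "(\<lambda>\<omega>. ?S (X \<omega>) * ?S (Y \<omega>)) = (\<lambda>\<omega>. T n (X \<omega>) * T n (Y \<omega>) + real n * T n (X \<omega>)
        + real n * T n (Y \<omega>) + real n * real n)"
      \<comment> \<open>The terms coming from the shift by \<open>real n\<close> agree on both sides
        of the inequality below and cancel, which leaves the claim for \<open>T n\<close>.\<close>
      by (auto simp: algebra_simps)
    have "expectation (\<lambda>\<omega>. ?S (X \<omega>)) * expectation (\<lambda>\<omega>. ?S (Y \<omega>))
        \<le> expectation (\<lambda>\<omega>. ?S (X \<omega>) * ?S (Y \<omega>))"
    proof (rule PQD_expectation_mult_nonneg)
      show "PQD M (\<lambda>\<omega>. ?S (X \<omega>)) (\<lambda>\<omega>. ?S (Y \<omega>))"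
        by (rule PQD_comp[OF pqd T_mono T_cont T_mono T_cont])
      show "integrable M (\<lambda>\<omega>. ?S (X \<omega>) * ?S (Y \<omega>))"
        unfolding expand using iT iTT by simp
    qed (use iT T_nonneg in simp_all)
    also have "\<dots> = expectation (\<lambda>\<omega>. T n (X \<omega>) * T n (Y \<omega>)) + real n * expectation (\<lambda>\<omega>. T n (X \<omega>))
        + real n * expectation (\<lambda>\<omega>. T n (Y \<omega>)) + real n * real n"
      unfolding expand using iT iTT by (simp add: prob_space)
    finally show ?thesis
      using iT by (simp add: prob_space algebra_simps)
  qed
  have "(\<lambda>n. expectation (\<lambda>\<omega>. T n (X \<omega>))) \<longlonglongrightarrow> expectation X"
    by (rule integral_dominated_convergence[where w="\<lambda>\<omega>. \<bar>X \<omega>\<bar>"])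
      (simp_all add: intX T_lim T_le)
  moreover have "(\<lambda>n. expectation (\<lambda>\<omega>. T n (Y \<omega>))) \<longlonglongrightarrow> expectation Y"
    by (rule integral_dominated_convergence[where w="\<lambda>\<omega>. \<bar>Y \<omega>\<bar>"])
      (simp_all add: intY T_lim T_le)
  ultimately have "(\<lambda>n. expectation (\<lambda>\<omega>. T n (X \<omega>)) * expectation (\<lambda>\<omega>. T n (Y \<omega>)))
      \<longlonglongrightarrow> expectation X * expectation Y"
    by (rule tendsto_mult)
  moreover have "(\<lambda>n. expectation (\<lambda>\<omega>. T n (X \<omega>) * T n (Y \<omega>))) \<longlonglongrightarrow> expectation (\<lambda>\<omega>. X \<omega> * Y \<omega>)"
  proof (rule integral_dominated_convergence[where w="\<lambda>\<omega>. \<bar>X \<omega> * Y \<omega>\<bar>"])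
    show "AE \<omega> in M. (\<lambda>n. T n (X \<omega>) * T n (Y \<omega>)) \<longlonglongrightarrow> X \<omega> * Y \<omega>"
      by (intro AE_I2 tendsto_mult T_lim)
    show "AE \<omega> in M. norm (T n (X \<omega>) * T n (Y \<omega>)) \<le> \<bar>X \<omega> * Y \<omega>\<bar>" for n
      unfolding real_norm_def by (intro AE_I2 TT_le)
    show "integrable M (\<lambda>\<omega>. \<bar>X \<omega> * Y \<omega>\<bar>)"
      using intXY by simp
  qed simp_all
  ultimately show ?thesis
    by (rule LIMSEQ_le) (blast intro: step)
qed

text \<open>Besides \<open>f\<close>, also \<open>g t = L t - f t\<close> is nondecreasing; the three covariances involving \<open>g\<close>
  in \<open>L\<^sup>2 Cov(X, Y) = Cov(f X + g X, f Y + g Y)\<close> are nonnegative.\<close>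

lemma (in prob_space) PQD_covariance_lipschitz:
  fixes f :: "real \<Rightarrow> real"
  assumes [measurable]: "X \<in> borel_measurable M" "Y \<in> borel_measurable M"
    and sq: "integrable M (\<lambda>\<omega>. (X \<omega>)\<^sup>2)" "integrable M (\<lambda>\<omega>. (Y \<omega>)\<^sup>2)"
    and pqd: "PQD M X Y"
    and f: "mono f" "continuous_on UNIV f" "\<And>t. \<bar>f t\<bar> \<le> B"
    and g: "mono (\<lambda>t. L * t - f t)"
  shows "expectation (\<lambda>\<omega>. f (X \<omega>) * f (Y \<omega>)) - expectation (\<lambda>\<omega>. f (X \<omega>)) * expectation (\<lambda>\<omega>. f (Y \<omega>))
    \<le> L\<^sup>2 * (expectation (\<lambda>\<omega>. X \<omega> * Y \<omega>) - expectation X * expectation Y)"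
proof -
  define g where "g t = L * t - f t" for t
  have gm: "mono g" "continuous_on UNIV g"
    using g f(2) unfolding g_def by (auto intro!: continuous_intros)
  have fmeas: "f \<in> borel_measurable borel" and gmeas: "g \<in> borel_measurable borel"
    using f(2) gm(2) by (auto intro: borel_measurable_continuous_onI)
  note [measurable] = fmeas gmeas
  have fsq: "integrable M (\<lambda>\<omega>. (f (Z \<omega>))\<^sup>2)" if [measurable]: "Z \<in> borel_measurable M" for Z
  proof (rule integrable_const_bound)
    have "(f t)\<^sup>2 \<le> B\<^sup>2" for t
      using power_mono[OF f(3)[of t], of 2] by simp
    then show "AE \<omega> in M. norm ((f (Z \<omega>))\<^sup>2) \<le> B\<^sup>2" by simp
  qed simp
  \<comment> \<open>Unlike \<open>f\<close>, the function \<open>g\<close> is unbounded, so the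
    square integrability of \<open>Z\<close> enters: the square of \<open>g Z\<close> expands into
    multiples of \<open>Z\<close> squared, of \<open>f Z * Z\<close> and of \<open>f Z\<close>
    squared.\<close>
  have gsq: "integrable M (\<lambda>\<omega>. (g (Z \<omega>))\<^sup>2)"
    if [measurable]: "Z \<in> borel_measurable M" and Z: "integrable M (\<lambda>\<omega>. (Z \<omega>)\<^sup>2)" for Z
  proof -
    have "integrable M (\<lambda>\<omega>. f (Z \<omega>) * Z \<omega>)"
      by (rule integrable_mult_of_squares) (simp_all add: Z fsq)
    then have "integrable M (\<lambda>\<omega>. L\<^sup>2 * (Z \<omega>)\<^sup>2 - 2 * L * (f (Z \<omega>) * Z \<omega>) + (f (Z \<omega>))\<^sup>2)"
      using Z fsq[OF that(1)] by simp
    also have "(\<lambda>\<omega>. L\<^sup>2 * (Z \<omega>)\<^sup>2 - 2 * L * (f (Z \<omega>) * Z \<omega>) + (f (Z \<omega>))\<^sup>2) = (\<lambda>\<omega>. (g (Z \<omega>))\<^sup>2)"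
      by (simp add: g_def fun_eq_iff power2_eq_square algebra_simps)
    finally show ?thesis .
  qed
  define A where "A = (\<lambda>\<omega>. f (X \<omega>))"
  define A' where "A' = (\<lambda>\<omega>. g (X \<omega>))"
  define C where "C = (\<lambda>\<omega>. f (Y \<omega>))"
  define C' where "C' = (\<lambda>\<omega>. g (Y \<omega>))"
  have sqs: "integrable M (\<lambda>\<omega>. (A \<omega>)\<^sup>2)" "integrable M (\<lambda>\<omega>. (A' \<omega>)\<^sup>2)"
      "integrable M (\<lambda>\<omega>. (C \<omega>)\<^sup>2)" "integrable M (\<lambda>\<omega>. (C' \<omega>)\<^sup>2)"
    unfolding A_def A'_def C_def C'_def by (intro fsq gsq sq; simp)+
  have [measurable]: "A \<in> borel_measurable M" "A' \<in> borel_measurable M"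
      "C \<in> borel_measurable M" "C' \<in> borel_measurable M"
    unfolding A_def A'_def C_def C'_def by measurable
  have pqds: "PQD M A C'" "PQD M A' C" "PQD M A' C'"
    unfolding A_def A'_def C_def C'_def
    by (rule PQD_comp[OF pqd f(1,2) gm] PQD_comp[OF pqd gm f(1,2)] PQD_comp[OF pqd gm gm])+
  have ints: "integrable M A" "integrable M A'" "integrable M C" "integrable M C'"
    using sqs by (simp_all add: square_integrable_imp_integrable)
  have prods: "integrable M (\<lambda>\<omega>. A \<omega> * C \<omega>)" "integrable M (\<lambda>\<omega>. A \<omega> * C' \<omega>)"
      "integrable M (\<lambda>\<omega>. A' \<omega> * C \<omega>)" "integrable M (\<lambda>\<omega>. A' \<omega> * C' \<omega>)"
    using sqs by (simp_all add: integrable_mult_of_squares)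
  have sums: "L * X \<omega> = A \<omega> + A' \<omega>" "L * Y \<omega> = C \<omega> + C' \<omega>" for \<omega>
    by (simp_all add: A_def A'_def C_def C'_def g_def)
  have "L\<^sup>2 * expectation (\<lambda>\<omega>. X \<omega> * Y \<omega>) = expectation (\<lambda>\<omega>. L\<^sup>2 * (X \<omega> * Y \<omega>))"
    by simp
  also have "\<dots> = expectation (\<lambda>\<omega>. (L * X \<omega>) * (L * Y \<omega>))"
    by (rule Bochner_Integration.integral_cong) (simp_all add: power2_eq_square)
  also have "\<dots> = expectation (\<lambda>\<omega>. A \<omega> * C \<omega> + A \<omega> * C' \<omega> + A' \<omega> * C \<omega> + A' \<omega> * C' \<omega>)"
    unfolding sums by (rule Bochner_Integration.integral_cong) (simp_all add: algebra_simps)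
  also have "\<dots> = expectation (\<lambda>\<omega>. A \<omega> * C \<omega>) + expectation (\<lambda>\<omega>. A \<omega> * C' \<omega>)
      + expectation (\<lambda>\<omega>. A' \<omega> * C \<omega>) + expectation (\<lambda>\<omega>. A' \<omega> * C' \<omega>)"
    using prods by simp
  also have "\<dots> \<ge> expectation (\<lambda>\<omega>. A \<omega> * C \<omega>) + expectation A * expectation C'
      + expectation A' * expectation C + expectation A' * expectation C'"
    by (intro add_mono PQD_expectation_mult order_refl sqs pqds) simp_all
  finally have 1: "expectation (\<lambda>\<omega>. A \<omega> * C \<omega>) + expectation A * expectation C'
      + expectation A' * expectation C + expectation A' * expectation C'
      \<le> L\<^sup>2 * expectation (\<lambda>\<omega>. X \<omega> * Y \<omega>)" .
  have "L * expectation X = expectation (\<lambda>\<omega>. L * X \<omega>)" "L * expectation Y = expectation (\<lambda>\<omega>. L * Y \<omega>)"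
    by simp_all
  then have 2: "L * expectation X = expectation A + expectation A'"
      "L * expectation Y = expectation C + expectation C'"
    unfolding sums using ints by simp_all
  have "L\<^sup>2 * (expectation X * expectation Y) = (L * expectation X) * (L * expectation Y)"
    by (simp add: power2_eq_square)
  then have "L\<^sup>2 * (expectation X * expectation Y) = expectation A * expectation C
      + expectation A * expectation C' + expectation A' * expectation C + expectation A' * expectation C'"
    unfolding 2 by (simp add: algebra_simps)
  with 1 have "expectation (\<lambda>\<omega>. A \<omega> * C \<omega>) - expectation A * expectation C
      \<le> L\<^sup>2 * (expectation (\<lambda>\<omega>. X \<omega> * Y \<omega>) - expectation X * expectation Y)"
    by (simp add: right_diff_distrib)
  then show ?thesis by (simp add: A_def C_def)
qed

section \<open>From summable weighted squares to convergence of averages\<close>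

text \<open>If |S n| \<ge> e n, then |S| stays above e n / 2 on the next e n / 2 indices. At least e
  n / 4 terms of the series are then of order 1/n, so this block contributes at least a constant
  independent of n, against the Cauchy criterion.\<close>

lemma slow_growth_of_summable_squares:
  fixes S :: "nat \<Rightarrow> real"
  assumes inc: "\<And>n. \<bar>S (Suc n) - S n\<bar> \<le> 1"
    and sm: "summable (\<lambda>n. (S (Suc n))\<^sup>2 / real (Suc n) ^ 3)"
  shows "(\<lambda>n. S n / real n) \<longlonglongrightarrow> 0"
proof (rule LIMSEQ_I)
  fix r :: real assume "0 < r"
  \<comment> \<open>The cap at 1 keeps the block inside [n, 2n], so that the cubes in the
    denominators are at most (2n)^3.\<close>
  define e where "e = min r 1"
  have e: "0 < e" "e \<le> 1" "e \<le> r" using \<open>0 < r\<close> by (auto simp: e_def)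
  \<comment> \<open>The lower bound (e/2)^2 / (8n) for one term times the lower bound e n / 4 for
    the block length; n cancels.\<close>
  define c where "c = (e / 2)\<^sup>2 / 8 * (e / 4)"
  have "c > 0" using e by (simp add: c_def)
  obtain N where N: "\<And>m n. m \<ge> N \<Longrightarrow> norm (\<Sum>k=m..<n. (S (Suc k))\<^sup>2 / real (Suc k) ^ 3) < c"
    using sm \<open>c > 0\<close> unfolding summable_Cauchy by blast
  have lip: "\<bar>S (n + k) - S n\<bar> \<le> real k" for n k
  proof (induction k)
    case (Suc k)
    then show ?case using inc[of "n + k"] by simp
  qed simp
  \<comment> \<open>From \<open>N'\<close> on, e n \<ge> 4, so rounding e n / 2 down to the integer
    \<open>h\<close> still leaves at least e n / 4.\<close>
  obtain N' :: nat where N': "4 / e \<le> real N'" using real_arch_simple by blast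
  show "\<exists>no. \<forall>n\<ge>no. norm (S n / real n - 0) < r"
  proof (intro exI[of _ "max 1 (max N N')"] allI impI)
    fix n :: nat assume n: "max 1 (max N N') \<le> n"
    show "norm (S n / real n - 0) < r"
    proof (rule ccontr)
      assume "\<not> ?thesis"
      then have "e \<le> \<bar>S n\<bar> / real n" using e by simp
      then have big: "e * real n \<le> \<bar>S n\<bar>" using n by (simp add: pos_le_divide_eq)
      define h where "h = nat \<lfloor>e * real n / 2\<rfloor>"
      have en: "4 \<le> e * real n"
      proof -
        have "4 / e \<le> real n" using N' n by linarith
        then show ?thesis using e by (simp add: field_simps)
      qed
      have h: "real h \<le> e * real n / 2" "e * real n / 4 \<le> real h"
        using en e unfolding h_def by linarith+
      have hn: "real h \<le> real n" using h(1) mult_right_mono[OF e(2), of "real n"] by simp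
      have summand: "(e / 2)\<^sup>2 / (8 * real n) \<le> (S (Suc k))\<^sup>2 / real (Suc k) ^ 3"
        if "k \<in> {n..<n+h}" for k
      proof -
        \<comment> \<open>The summand with index \<open>k\<close> involves \<open>S (Suc k)\<close>,
          so the distance \<open>j\<close> from \<open>n\<close> runs from 1 to \<open>h\<close>,
          and the loss |S (n + j) - S n| \<le> j is at most e n / 2.\<close>
        define j where "j = Suc k - n"
        have j: "Suc k = n + j" "j \<le> h" using that by (auto simp: j_def)
        have "e / 2 * real n \<le> \<bar>S (Suc k)\<bar>"
          using lip[of n j] big h(1) j by simp
        then have "(e / 2 * real n)\<^sup>2 \<le> (S (Suc k))\<^sup>2"
          using e by (metis abs_le_square_iff abs_of_nonneg half_gt_zero_iff less_imp_le mult_nonneg_nonneg of_nat_0_le_iff)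
        moreover have "real (Suc k) ^ 3 \<le> (2 * real n) ^ 3"
          using j hn by (intro power_mono) simp_all
        ultimately have "(e / 2 * real n)\<^sup>2 / (2 * real n) ^ 3 \<le> (S (Suc k))\<^sup>2 / real (Suc k) ^ 3"
          by (intro frac_le) auto
        also have "(e / 2 * real n)\<^sup>2 / (2 * real n) ^ 3 = (e / 2)\<^sup>2 / (8 * real n)"
          using n by (simp add: power2_eq_square power3_eq_cube field_simps)
        finally show ?thesis .
      qed
      have "c = e * real n / 4 * ((e / 2)\<^sup>2 / (8 * real n))"
        using n by (simp add: c_def field_simps)
      also have "\<dots> \<le> real h * ((e / 2)\<^sup>2 / (8 * real n))"
        using h(2) by (intro mult_right_mono) auto
      also have "\<dots> = (\<Sum>k=n..<n+h. (e / 2)\<^sup>2 / (8 * real n))" by simp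
      also have "\<dots> \<le> (\<Sum>k=n..<n+h. (S (Suc k))\<^sup>2 / real (Suc k) ^ 3)"
        by (intro sum_mono summand)
      also have "\<dots> < c" using N[of n "n+h"] n by simp
      finally show False by simp
    qed
  qed
qed

section \<open>Local times\<close>

lemma local_time_le_max: "local_time z n l \<le> max_local_time z n"
proof -
  have "local_time z n i \<le> n" for i
    unfolding local_time_def using card_mono[of "{..<n}" "{k. k < n \<and> z k = i}"] by auto
  then have "range (local_time z n) \<subseteq> {..n}" by auto
  then have "finite (range (local_time z n))" by (rule finite_subset) simp
  then show ?thesis unfolding max_local_time_def by (rule Max_ge) simp
qed

text \<open>Grouping the times by visited site, each site counts at most
  \<open>max_local_time z n\<close> times, and the distinct sites translated by \<open>a\<close>
  form a finite set, to which \<open>bd\<close> applies. The bound is uniform in \<open>a\<close>;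
  it will serve with \<open>a = z j\<close>.\<close>

lemma sum_along_path_le:
  fixes D :: "'a :: ab_group_add \<Rightarrow> real"
  assumes nn: "\<And>l. 0 \<le> D l" and bd: "\<And>A. finite A \<Longrightarrow> sum D A \<le> K"
  shows "(\<Sum>k<n. D (z k - a)) \<le> real (max_local_time z n) * K"
proof -
  have "(\<Sum>k<n. D (z k - a)) = (\<Sum>l\<in>z ` {..<n}. real (card {k \<in> {..<n}. z k = l}) * D (l - a))"
    by (rule sum_fun_comp) auto
  also have "\<dots> \<le> (\<Sum>l\<in>z ` {..<n}. real (max_local_time z n) * D (l - a))"
    using local_time_le_max[of z n] nn
    by (intro sum_mono mult_right_mono) (auto simp: local_time_def)
  also have "\<dots> = real (max_local_time z n) * sum D ((\<lambda>l. l - a) ` z ` {..<n})"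
    by (subst sum.reindex) (auto simp: sum_distrib_left inj_on_def)
  also have "\<dots> \<le> real (max_local_time z n) * K"
    by (intro mult_left_mono bd) auto
  finally show ?thesis .
qed

section \<open>Polya's theorem\<close>

text \<open>Every \<open>s\<close> is compared with a quantile of a neighbouring level i/N, where
  convergence holds simultaneously because there are finitely many such levels. Continuity of the
  limit enters through the exact quantiles \<open>q\<close>. Restricting to rational levels allows
  almost sure convergence to be invoked for a countable family.\<close>

lemma uniform_limit_of_quantiles:
  fixes F :: "real \<Rightarrow> real"
  assumes F: "\<And>s. 0 \<le> F s" "\<And>s. F s \<le> 1" "mono F"
    and G: "\<And>n s. 0 \<le> G n s" "\<And>n s. G n s \<le> 1" "\<And>n. mono (G n)"
    and q: "\<And>p. p \<in> \<rat> \<Longrightarrow> 0 < p \<Longrightarrow> p < 1 \<Longrightarrow> F (q p) = p"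
    and lim: "\<And>p. p \<in> \<rat> \<Longrightarrow> 0 < p \<Longrightarrow> p < 1 \<Longrightarrow> (\<lambda>n. G n (q p)) \<longlonglongrightarrow> F (q p)"
  shows "uniform_limit UNIV G F sequentially"
proof (rule uniform_limitI)
  fix e :: real assume "0 < e"
  obtain N :: nat where N: "3 / e < real N" using reals_Archimedean2 by blast
  have "0 < 3 / e" using \<open>0 < e\<close> by simp
  then have Npos: "0 < real N" using N by linarith
  \<comment> \<open>One \<open>u\<close> pays for the mesh of the levels and one for the error at a
    quantile.\<close>
  define u where "u = 1 / real N"
  have u: "0 < u" "2 * u < e" using N \<open>0 < e\<close> Npos by (simp_all add: u_def field_simps)
  define p where "p i = real i / real N" for i
  have p: "p i \<in> \<rat>" "0 < p i" "p i < 1" if "i \<in> {1..<N}" for i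
    using that by (auto simp: p_def)
  have "\<forall>\<^sub>F n in sequentially. \<forall>i\<in>{1..<N}. dist (G n (q (p i))) (F (q (p i))) < u"
    using u by (intro eventually_ball_finite ballI tendstoD[OF lim] p) auto
  then show "\<forall>\<^sub>F n in sequentially. \<forall>s\<in>UNIV. dist (G n s) (F s) < e"
  proof eventually_elim
    case (elim n)
    have cl: "\<bar>G n (q (p i)) - p i\<bar> < u" if "i \<in> {1..<N}" for i
      using bspec[OF elim that] q[OF p[OF that]] by (simp add: dist_real_def)
    show ?case
    proof
      fix s
      have lower: "F s - 2 * u < G n s"
      proof -
        \<comment> \<open>The largest integer strictly below F s * N, or 0 if F s = 0. Strictness
          gives \<open>q (p j) \<le> s\<close> by monotonicity. Level 0 has no assigned quantile;
          there \<open>G n s \<ge> 0\<close> suffices.\<close>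
        define j where "j = nat (\<lceil>F s * real N\<rceil> - 1)"
        have j: "F s * real N - 1 \<le> real j" "0 < j \<Longrightarrow> real j < F s * real N"
          unfolding j_def by linarith+
        have jF: "F s - u \<le> p j"
          using divide_right_mono[OF j(1), of "real N"] Npos
          by (simp add: p_def u_def diff_divide_distrib)
        show ?thesis
        proof (cases "j = 0")
          case True
          then have "p j = 0" by (simp add: p_def)
          then show ?thesis using jF G(1)[of n s] u by linarith
        next
          case False
          then have Fj: "p j < F s" using j(2) Npos by (simp add: p_def field_simps)
          with F(2)[of s] have "p j < 1" by linarith
          then have ji: "j \<in> {1..<N}" using False Npos by (simp add: p_def)
          have "q (p j) \<le> s"
            using Fj q[OF p[OF ji]] monoD[OF F(3), of s "q (p j)"] by linarith
          then have "G n (q (p j)) \<le> G n s" by (rule monoD[OF G(3)])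
          then show ?thesis using cl[OF ji] jF by linarith
        qed
      qed
      have upper: "G n s < F s + 2 * u"
      proof -
        \<comment> \<open>The smallest integer strictly above F s * N. If the level reaches 1, where
          no quantile is assigned, the bound \<open>G n s \<le> 1\<close> suffices.\<close>
        define j where "j = nat (\<lfloor>F s * real N\<rfloor> + 1)"
        have "0 \<le> F s * real N" using F(1)[of s] by simp
        then have j: "real j \<le> F s * real N + 1" "F s * real N < real j" "0 < j"
          unfolding j_def by linarith+
        have jF: "p j \<le> F s + u"
          using divide_right_mono[OF j(1), of "real N"] Npos
          by (simp add: p_def u_def add_divide_distrib)
        have Fj: "F s < p j" using j(2) Npos by (simp add: p_def pos_less_divide_eq)
        show ?thesis
        proof (cases "j < N")
          case False
          then have "1 \<le> p j" using Npos by (simp add: p_def)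
          then show ?thesis using jF G(2)[of n s] u by linarith
        next
          case True
          then have ji: "j \<in> {1..<N}" using j(3) by simp
          have "s \<le> q (p j)"
            using Fj q[OF p[OF ji]] monoD[OF F(3), of "q (p j)" s] by linarith
          then have "G n s \<le> G n (q (p j))" by (rule monoD[OF G(3)])
          then show ?thesis using cl[OF ji] jF by linarith
        qed
      qed
      show "dist (G n s) (F s) < e"
        using lower upper u by (simp add: dist_real_def)
    qed
  qed
qed

section \<open>Strong law for ramps of the field along the path\<close>

text \<open>The product is a function of the coordinates at \<open>i - j\<close> and 0, and its
  expectation is unchanged when both are translated by \<open>j\<close>.\<close>

lemma (in prob_space) strictly_stationary_expectation_mult:
  fixes X :: "'i :: ab_group_add \<Rightarrow> 'a \<Rightarrow> real"
  assumes [measurable]: "\<And>l. X l \<in> borel_measurable M" and stat: "strictly_stationary M X"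
  shows "expectation (\<lambda>\<omega>. X i \<omega> * X j \<omega>) = expectation (\<lambda>\<omega>. X (i - j) \<omega> * X 0 \<omega>)"
proof -
  define J where "J = {i - j, 0}"
  have J: "i - j \<in> J" "0 \<in> J" "finite J" by (auto simp: J_def)
  have [measurable]: "(\<lambda>v. v (i - j) * v 0) \<in> borel_measurable (Pi\<^sub>M J (\<lambda>_. borel :: real measure))"
    using J by (intro borel_measurable_times measurable_component_singleton)
  have [measurable]: "(\<lambda>\<omega>. \<lambda>l\<in>J. X (l + h) \<omega>) \<in> measurable M (Pi\<^sub>M J (\<lambda>_. borel))" for h
    by (intro measurable_restrict) simp
  have int: "(\<integral>v. v (i - j) * v 0 \<partial>distr M (Pi\<^sub>M J (\<lambda>_. borel)) (\<lambda>\<omega>. \<lambda>l\<in>J. X (l + h) \<omega>))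
      = expectation (\<lambda>\<omega>. X (i - j + h) \<omega> * X (0 + h) \<omega>)" for h
    using J by (subst integral_distr) simp_all
  \<comment> \<open>Writing the untranslated field as a translation by 0 makes \<open>int\<close>
    applicable to both sides.\<close>
  have "distr M (Pi\<^sub>M J (\<lambda>_. borel)) (\<lambda>\<omega>. \<lambda>l\<in>J. X (l + j) \<omega>)
      = distr M (Pi\<^sub>M J (\<lambda>_. borel)) (\<lambda>\<omega>. \<lambda>l\<in>J. X (l + 0) \<omega>)"
    using stat J(3) by (simp add: strictly_stationary_def)
  from int[of j, unfolded this int] show ?thesis by simp
qed

text \<open>The variance bound, divided by n^3, is a multiple of the summand in \<open>loc\<close>.
  The hypothesis \<open>lip\<close> expresses, for nondecreasing \<open>f\<close>, that
  \<open>f\<close> is Lipschitz with constant \<open>L\<close>, in the form that the covariance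
  inequality uses.\<close>

lemma (in prob_space) PQD_field_strong_law:
  fixes X :: "'i :: ab_group_add \<Rightarrow> 'a \<Rightarrow> real" and f :: "real \<Rightarrow> real"
  assumes [measurable]: "\<And>l. X l \<in> borel_measurable M"
    and sq: "\<And>l. integrable M (\<lambda>\<omega>. (X l \<omega>)\<^sup>2)"
    and centered: "\<And>l. expectation (X l) = 0"
    and stat: "strictly_stationary M X"
    and pqd: "pairwise_PQD M X"
    and cov: "(\<lambda>l. expectation (\<lambda>\<omega>. X l \<omega> * X 0 \<omega>)) summable_on UNIV"
    and loc: "summable (\<lambda>n. real (max_local_time z (Suc n)) / (real (Suc n))\<^sup>2)"
    and f: "mono f" "continuous_on UNIV f" "\<And>t. 0 \<le> f t" "\<And>t. f t \<le> 1"
    and lip: "mono (\<lambda>t. L * t - f t)"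
  shows "AE \<omega> in M. (\<lambda>n. (\<Sum>k<n. f (X (z k) \<omega>) - expectation (\<lambda>\<omega>. f (X (z k) \<omega>))) / real n) \<longlonglongrightarrow> 0"
proof -
  define c where "c l = expectation (\<lambda>\<omega>. X l \<omega> * X 0 \<omega>)" for l
  \<comment> \<open>A translation invariant majorant for the covariances of the \<open>V l\<close>.
    The extra 1 at the origin covers the diagonal, since \<open>pairwise_PQD\<close> concerns
    distinct indices only. \<open>K\<close> bounds all finite sums of \<open>D\<close>.\<close>
  define D where "D l = L\<^sup>2 * c l + (if l = 0 then 1 else 0)" for l
  define K where "K = L\<^sup>2 * infsum c UNIV + 1"
  define V where "V l \<omega> = f (X l \<omega>) - expectation (\<lambda>\<omega>. f (X l \<omega>))" for l \<omega>
  define S where "S n \<omega> = (\<Sum>k<n. V (z k) \<omega>)" for n \<omega>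
  have [measurable]: "f \<in> borel_measurable borel"
    using f(2) by (rule borel_measurable_continuous_onI)
  have [measurable]: "V l \<in> borel_measurable M" for l
    unfolding V_def by measurable
  have [measurable]: "S n \<in> borel_measurable M" for n
    unfolding S_def by measurable
  have f_int: "integrable M (\<lambda>\<omega>. f (X l \<omega>))" for l
    using f(3,4) by (intro integrable_const_bound[where B=1]) auto
  have ff_int: "integrable M (\<lambda>\<omega>. f (X i \<omega>) * f (X j \<omega>))" for i j
    using f(3,4) by (intro integrable_const_bound[where B=1]) (auto intro!: mult_le_one simp: abs_mult)
  have E_bounds: "0 \<le> expectation (\<lambda>\<omega>. f (X l \<omega>))" "expectation (\<lambda>\<omega>. f (X l \<omega>)) \<le> 1" for l
  proof -
    show "0 \<le> expectation (\<lambda>\<omega>. f (X l \<omega>))" using f(3) by simp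
    have "expectation (\<lambda>\<omega>. f (X l \<omega>)) \<le> expectation (\<lambda>_. 1)"
      by (intro integral_mono f_int f(4)) simp
    then show "expectation (\<lambda>\<omega>. f (X l \<omega>)) \<le> 1" by (simp add: prob_space)
  qed
  have V_abs: "\<bar>V l \<omega>\<bar> \<le> 1" for l \<omega>
    using E_bounds[of l] f(3)[of "X l \<omega>"] f(4)[of "X l \<omega>"] unfolding V_def by linarith
  have VV_abs: "\<bar>V i \<omega> * V j \<omega>\<bar> \<le> 1" for i j \<omega>
    using V_abs by (simp add: abs_mult mult_le_one)
  have VV_int: "integrable M (\<lambda>\<omega>. V i \<omega> * V j \<omega>)" for i j
    using VV_abs by (intro integrable_const_bound[where B=1]) auto

  \<comment> \<open>By centering, \<open>c l\<close> is a covariance. Its sign is what bounds finite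
    sums of \<open>c\<close> by the full sum.\<close>
  have c_nonneg: "0 \<le> c l" for l
  proof (cases "l = 0")
    case False
    then have "PQD M (X l) (X 0)" using pqd by (simp add: pairwise_PQD_def)
    from PQD_expectation_mult[OF _ _ sq sq this] show ?thesis by (simp add: c_def centered)
  qed (simp add: c_def)
  have D_nonneg: "0 \<le> D l" for l
    using c_nonneg by (simp add: D_def)
  have D_sum: "sum D A \<le> K" if "finite A" for A
  proof -
    have "sum D A = L\<^sup>2 * sum c A + (\<Sum>l\<in>A. if l = 0 then 1 else 0)"
      by (simp add: D_def sum.distrib sum_distrib_left)
    also have "(\<Sum>l\<in>A. if l = 0 then 1 else 0) \<le> (1::real)"
      using that by (simp add: sum.delta)
    also have "sum c A \<le> infsum c UNIV"
      using cov that c_nonneg by (intro finite_sum_le_infsum) (simp_all add: c_def[abs_def])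
    finally show ?thesis by (simp add: K_def mult_left_mono)
  qed
  have VV_cov: "expectation (\<lambda>\<omega>. V i \<omega> * V j \<omega>) \<le> D (i - j)" for i j
  proof (cases "i = j")
    case True
    have "expectation (\<lambda>\<omega>. V i \<omega> * V j \<omega>) \<le> expectation (\<lambda>_. 1)"
      by (intro integral_mono VV_int order_trans[OF abs_ge_self VV_abs]) simp
    also have "\<dots> \<le> D (i - j)"
      using True c_nonneg[of 0] by (simp add: D_def prob_space)
    finally show ?thesis .
  next
    case False
    then have "PQD M (X i) (X j)" using pqd by (simp add: pairwise_PQD_def)
    then have le: "expectation (\<lambda>\<omega>. f (X i \<omega>) * f (X j \<omega>))
        - expectation (\<lambda>\<omega>. f (X i \<omega>)) * expectation (\<lambda>\<omega>. f (X j \<omega>))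
        \<le> L\<^sup>2 * (expectation (\<lambda>\<omega>. X i \<omega> * X j \<omega>) - expectation (X i) * expectation (X j))"
      using f lip by (intro PQD_covariance_lipschitz[where B=1] sq) auto
    have "expectation (\<lambda>\<omega>. V i \<omega> * V j \<omega>) = expectation (\<lambda>\<omega>. f (X i \<omega>) * f (X j \<omega>)
        - expectation (\<lambda>\<omega>. f (X j \<omega>)) * f (X i \<omega>) - expectation (\<lambda>\<omega>. f (X i \<omega>)) * f (X j \<omega>)
        + expectation (\<lambda>\<omega>. f (X i \<omega>)) * expectation (\<lambda>\<omega>. f (X j \<omega>)))"
      by (rule Bochner_Integration.integral_cong) (simp_all add: V_def algebra_simps)
    also have "\<dots> = expectation (\<lambda>\<omega>. f (X i \<omega>) * f (X j \<omega>))
        - expectation (\<lambda>\<omega>. f (X i \<omega>)) * expectation (\<lambda>\<omega>. f (X j \<omega>))"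
      by (simp add: f_int ff_int prob_space)
    also have "\<dots> \<le> L\<^sup>2 * c (i - j)"
      using le strictly_stationary_expectation_mult[OF assms(1) stat, of i j] centered
      by (simp add: c_def)
    also have "\<dots> = D (i - j)" using False by (simp add: D_def)
    finally show ?thesis .
  qed

  have S_sq: "(S n \<omega>)\<^sup>2 = (\<Sum>j<n. \<Sum>k<n. V (z k) \<omega> * V (z j) \<omega>)" for n \<omega>
    by (simp add: S_def power2_eq_square sum_product mult.commute)
  have S_int: "integrable M (\<lambda>\<omega>. (S n \<omega>)\<^sup>2)" for n
    unfolding S_sq by (intro Bochner_Integration.integrable_sum VV_int)
  have S_var: "expectation (\<lambda>\<omega>. (S n \<omega>)\<^sup>2) \<le> real n * (real (max_local_time z n) * K)" for n
  proof -
    have "expectation (\<lambda>\<omega>. (S n \<omega>)\<^sup>2) = (\<Sum>j<n. \<Sum>k<n. expectation (\<lambda>\<omega>. V (z k) \<omega> * V (z j) \<omega>))"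
      unfolding S_sq by (simp add: VV_int)
    \<comment> \<open>For fixed \<open>j\<close> the inner sum follows the path seen from
      \<open>z j\<close>, so the local times bound it uniformly in \<open>j\<close>.\<close>
    also have "\<dots> \<le> (\<Sum>j<n. \<Sum>k<n. D (z k - z j))"
      by (intro sum_mono VV_cov)
    also have "\<dots> \<le> (\<Sum>j<n. real (max_local_time z n) * K)"
      by (intro sum_mono sum_along_path_le D_nonneg D_sum)
    finally show ?thesis by simp
  qed
  define Q where "Q n \<omega> = (S (Suc n) \<omega>)\<^sup>2 / real (Suc n) ^ 3" for n \<omega>
  have Q_exp: "expectation (Q n) \<le> K * (real (max_local_time z (Suc n)) / (real (Suc n))\<^sup>2)" for n
  proof -
    have "expectation (Q n) = expectation (\<lambda>\<omega>. (S (Suc n) \<omega>)\<^sup>2) / real (Suc n) ^ 3"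
      unfolding Q_def by simp
    also have "\<dots> \<le> real (Suc n) * (real (max_local_time z (Suc n)) * K) / real (Suc n) ^ 3"
      by (intro divide_right_mono S_var) simp
    also have "\<dots> = K * (real (max_local_time z (Suc n)) / (real (Suc n))\<^sup>2)"
      by (simp add: power2_eq_square power3_eq_cube del: of_nat_Suc)
    finally show ?thesis .
  qed
  have Q_nonneg: "0 \<le> Q n \<omega>" for n \<omega> by (simp add: Q_def)
  have Q_int: "integrable M (Q n)" for n
    unfolding Q_def by (simp add: S_int)
  have [measurable]: "Q n \<in> borel_measurable M" for n
    unfolding Q_def by measurable
  have "summable (\<lambda>n. expectation (Q n))"
  proof (rule summable_comparison_test')
    show "summable (\<lambda>n. K * (real (max_local_time z (Suc n)) / (real (Suc n))\<^sup>2))"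
      using loc by (rule summable_mult)
    show "norm (expectation (Q n)) \<le> K * (real (max_local_time z (Suc n)) / (real (Suc n))\<^sup>2)" for n
      using Q_exp Q_nonneg by simp
  qed
  \<comment> \<open>The sum of the expectations is the expectation of the sum; being finite, it
    forces the sum to be finite almost surely.\<close>
  then have "(\<Sum>n. ennreal (expectation (Q n))) \<noteq> \<top>"
    by (rule ennreal_suminf_neq_top) (simp add: Q_nonneg)
  then have "(\<integral>\<^sup>+\<omega>. (\<Sum>n. ennreal (Q n \<omega>)) \<partial>M) \<noteq> \<infinity>"
    by (simp add: nn_integral_suminf nn_integral_eq_integral Q_int Q_nonneg)
  then have "AE \<omega> in M. (\<Sum>n. ennreal (Q n \<omega>)) \<noteq> \<infinity>"
    by (intro nn_integral_PInf_AE) simp_all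
  then have "AE \<omega> in M. (\<lambda>n. S n \<omega> / real n) \<longlonglongrightarrow> 0"
  proof eventually_elim
    case (elim \<omega>)
    then have "summable (\<lambda>n. Q n \<omega>)"
      by (intro summable_suminf_not_top) (simp_all add: Q_nonneg)
    then show ?case
      unfolding Q_def by (intro slow_growth_of_summable_squares) (simp_all add: S_def V_abs)
  qed
  then show ?thesis by (simp add: S_def V_def)
qed

section \<open>From ramps to empirical distribution functions\<close>

text \<open>The function 1 - f lies between the indicators of \<open>{..a}\<close> and
  \<open>{..b}\<close>. One of these comparisons is averaged over the sample and the other is taken
  in expectation; passing from \<open>f\<close> to 1 - f gives the centered average its minus
  sign.\<close>

lemma (in prob_space) empirical_cdf_ramp_bounds:
  fixes X :: "'i \<Rightarrow> 'a \<Rightarrow> real" and F :: "real \<Rightarrow> real"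
  assumes [measurable]: "\<And>l. X l \<in> borel_measurable M"
    and F: "\<And>l. cdf (distr M borel (X l)) = F"
    and f: "f \<in> borel_measurable borel" "\<And>t. 0 \<le> f t" "\<And>t. f t \<le> 1"
      "\<And>t. t \<le> a \<Longrightarrow> f t = 0" "\<And>t. b < t \<Longrightarrow> f t = 1"
    and "0 < n"
  shows "empirical_cdf X z \<omega> n a
      \<le> F b - (\<Sum>k<n. f (X (z k) \<omega>) - expectation (\<lambda>\<omega>. f (X (z k) \<omega>))) / real n" (is ?upper)
    and "F a - (\<Sum>k<n. f (X (z k) \<omega>) - expectation (\<lambda>\<omega>. f (X (z k) \<omega>))) / real n
      \<le> empirical_cdf X z \<omega> n b" (is ?lower)
proof -
  note [measurable] = f(1)
  let ?E = "\<lambda>l. expectation (\<lambda>\<omega>. f (X l \<omega>))"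
  have int: "integrable M (\<lambda>\<omega>. f (X l \<omega>))" for l
    using f(2,3) by (intro integrable_const_bound[where B=1]) auto
  have F_eq: "F t = expectation (\<lambda>\<omega>. indicator {..t} (X l \<omega>))" for t l
  proof -
    have "F t = prob {\<omega> \<in> space M. X l \<omega> \<le> t}"
      by (simp flip: F[of l] add: cdf_def measure_distr vimage_def Int_def conj_commute)
    also have "\<dots> = expectation (indicator {\<omega> \<in> space M. X l \<omega> \<le> t})"
      by simp
    also have "\<dots> = expectation (\<lambda>\<omega>. indicator {..t} (X l \<omega>))"
      by (rule Bochner_Integration.integral_cong) (auto simp: indicator_def)
    finally show ?thesis .
  qed
  have ind_int: "integrable M (\<lambda>\<omega>. indicator {..t} (X l \<omega>) :: real)" for t l
    by (intro integrable_const_bound[where B=1]) (auto simp: indicator_def)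
  have le: "indicator {..a} t \<le> 1 - f t" "1 - f t \<le> indicator {..b} t" for t
    using f(2,3)[of t] f(4,5)[of t] by (auto simp: indicator_def not_le)
  have E_le: "F a \<le> 1 - ?E l" "1 - ?E l \<le> F b" for l
  proof -
    have *: "1 - ?E l = expectation (\<lambda>\<omega>. 1 - f (X l \<omega>))"
      by (simp add: int prob_space)
    show "F a \<le> 1 - ?E l" "1 - ?E l \<le> F b"
      unfolding * F_eq[of _ l] by (intro integral_mono le ind_int Bochner_Integration.integrable_diff int; simp)+
  qed
  have mean: "(\<Sum>k<n. 1 - f (X (z k) \<omega>)) / real n
      = (\<Sum>k<n. 1 - ?E (z k)) / real n - (\<Sum>k<n. f (X (z k) \<omega>) - ?E (z k)) / real n"
    by (simp add: sum_subtractf diff_divide_distrib)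
  have "empirical_cdf X z \<omega> n a \<le> (\<Sum>k<n. 1 - f (X (z k) \<omega>)) / real n"
    unfolding empirical_cdf_def by (simp add: divide_right_mono sum_mono le)
  moreover have "(\<Sum>k<n. 1 - ?E (z k)) / real n \<le> F b"
    using sum_mono[of "{..<n}" "\<lambda>k. 1 - ?E (z k)" "\<lambda>_. F b"] E_le \<open>0 < n\<close>
    by (simp add: pos_divide_le_eq mult.commute)
  ultimately show ?upper unfolding mean by linarith
  have "(\<Sum>k<n. 1 - f (X (z k) \<omega>)) / real n \<le> empirical_cdf X z \<omega> n b"
    unfolding empirical_cdf_def by (simp add: divide_right_mono sum_mono le)
  moreover have "F a \<le> (\<Sum>k<n. 1 - ?E (z k)) / real n"
    using sum_mono[of "{..<n}" "\<lambda>_. F a" "\<lambda>k. 1 - ?E (z k)"] E_le \<open>0 < n\<close>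
    by (simp add: pos_le_divide_eq mult.commute)
  ultimately show ?lower unfolding mean by linarith
qed

lemma mono_clamp: "mono (\<lambda>t. min 1 (max 0 ((t - a) / d)))" if "0 < d" for a d :: real
proof (rule monoI)
  fix x y :: real assume "x \<le> y"
  then have "(x - a) / d \<le> (y - a) / d" using that by (intro divide_right_mono) auto
  then show "min 1 (max 0 ((x - a) / d)) \<le> min 1 (max 0 ((y - a) / d))" by linarith
qed

text \<open>This is the Lipschitz property of the ramp, with constant 1/d, in the form required by
  \<open>PQD_field_strong_law\<close>.\<close>

lemma mono_minus_clamp:
  "mono (\<lambda>t. (1 / d) * t - min 1 (max 0 ((t - a) / d)))" if "0 < d" for a d :: real
proof (rule monoI)
  fix x y :: real assume "x \<le> y"
  then have "(x - a) / d \<le> (y - a) / d" using that by (intro divide_right_mono) auto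
  then have "(x - a) / d - min 1 (max 0 ((x - a) / d)) \<le> (y - a) / d - min 1 (max 0 ((y - a) / d))"
    by linarith
  then show "(1 / d) * x - min 1 (max 0 ((x - a) / d)) \<le> (1 / d) * y - min 1 (max 0 ((y - a) / d))"
    by (simp add: diff_divide_distrib)
qed

text \<open>A ramp rising on [s, s + d] bounds the empirical value at \<open>s\<close> from above by
  F(s + d), and one rising on [s - d, s] bounds it from below by F(s - d), up to averages that tend
  to 0. Continuity of \<open>F\<close> at \<open>s\<close> closes the gap.\<close>

lemma (in prob_space) PQD_field_empirical_cdf_tendsto:
  fixes X :: "'i :: ab_group_add \<Rightarrow> 'a \<Rightarrow> real" and F :: "real \<Rightarrow> real"
  assumes meas: "\<And>l. X l \<in> borel_measurable M"
    and sq: "\<And>l. integrable M (\<lambda>\<omega>. (X l \<omega>)\<^sup>2)"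
    and centered: "\<And>l. expectation (X l) = 0"
    and stat: "strictly_stationary M X"
    and pqd: "pairwise_PQD M X"
    and F: "\<And>l. cdf (distr M borel (X l)) = F"
    and cov: "(\<lambda>l. expectation (\<lambda>\<omega>. X l \<omega> * X 0 \<omega>)) summable_on UNIV"
    and loc: "summable (\<lambda>n. real (max_local_time z (Suc n)) / (real (Suc n))\<^sup>2)"
    and cont: "isCont F s"
  shows "AE \<omega> in M. (\<lambda>n. empirical_cdf X z \<omega> n s) \<longlonglongrightarrow> F s"
proof -
  define f where "f a d t = min 1 (max 0 ((t - a) / d))" for a d t :: real
  define Z where "Z a d n \<omega> = (\<Sum>k<n. f a d (X (z k) \<omega>) - expectation (\<lambda>\<omega>. f a d (X (z k) \<omega>))) / real n"
    for a d n \<omega>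
  have f_cont: "continuous_on UNIV (f a d)" if "0 < d" for a d
    using that unfolding f_def by (intro continuous_intros) auto
  have f_meas: "f a d \<in> borel_measurable borel" if "0 < d" for a d
    using f_cont[OF that] by (rule borel_measurable_continuous_onI)
  have f_range: "0 \<le> f a d t" "f a d t \<le> 1" for a d t
    by (auto simp: f_def)
  have f_0: "f a d t = 0" if "0 < d" "t \<le> a" for a d t
    using divide_nonpos_pos[of "t - a" d] that unfolding f_def by linarith
  have f_1: "f a d t = 1" if "0 < d" "a + d < t" for a d t
  proof -
    have "1 \<le> (t - a) / d" using that by (simp add: pos_le_divide_eq)
    then show ?thesis unfolding f_def by linarith
  qed
  have Z_lim: "AE \<omega> in M. (\<lambda>n. Z a d n \<omega>) \<longlonglongrightarrow> 0" if "0 < d" for a d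
    unfolding Z_def
    by (rule PQD_field_strong_law[OF meas sq centered stat pqd cov loc, where L="1 / d"])
      (use that f_cont f_range mono_clamp mono_minus_clamp in \<open>simp_all add: f_def\<close>)
  \<comment> \<open>Countably many widths suffice, so one null set serves for all of them.\<close>
  define d where "d m = 1 / real (Suc m)" for m
  have d: "0 < d m" for m by (simp add: d_def)
  have "AE \<omega> in M. \<forall>m. (\<lambda>n. Z s (d m) n \<omega>) \<longlonglongrightarrow> 0 \<and> (\<lambda>n. Z (s - d m) (d m) n \<omega>) \<longlonglongrightarrow> 0"
    using Z_lim d by (simp add: AE_all_countable)
  then show ?thesis
  proof eventually_elim
    case (elim \<omega>)
    show ?case
    proof (rule LIMSEQ_I)
      fix r :: real assume "0 < r"
      then obtain e where e: "0 < e" "\<And>t. dist t s < e \<Longrightarrow> dist (F t) (F s) < r / 2"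
        using cont half_gt_zero[OF \<open>0 < r\<close>] unfolding continuous_at_eps_delta by metis
      obtain m where "d m < e"
        using nat_approx_posE[OF e(1)] unfolding d_def by metis
      then have "dist (s + d m) s < e" "dist (s - d m) s < e"
        using d[of m] by (simp_all add: dist_real_def)
      from this[THEN e(2)] have Fs: "F (s + d m) < F s + r / 2" "F s - r / 2 < F (s - d m)"
        unfolding dist_real_def by linarith+
      have "\<forall>\<^sub>F n in sequentially. \<bar>Z s (d m) n \<omega>\<bar> < r / 2"
        "\<forall>\<^sub>F n in sequentially. \<bar>Z (s - d m) (d m) n \<omega>\<bar> < r / 2"
        using elim \<open>0 < r\<close> by (auto dest!: spec[of _ m] tendstoD[where e="r / 2"] simp: dist_real_def)
      then have "\<forall>\<^sub>F n in sequentially. norm (empirical_cdf X z \<omega> n s - F s) < r"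
        using eventually_gt_at_top[of 0]
      proof eventually_elim
        case (elim n)
        have "empirical_cdf X z \<omega> n s \<le> F (s + d m) - Z s (d m) n \<omega>"
          unfolding Z_def
          by (rule empirical_cdf_ramp_bounds(1)[OF meas F])
            (use elim d f_meas f_range f_0 f_1 in auto)
        moreover have "F (s - d m) - Z (s - d m) (d m) n \<omega> \<le> empirical_cdf X z \<omega> n s"
          unfolding Z_def
          by (rule empirical_cdf_ramp_bounds(2)[OF meas F])
            (use elim d f_meas f_range f_0 f_1[of "d m" "s - d m"] in auto)
        ultimately show ?case
          using elim Fs unfolding real_norm_def by linarith
      qed
      then show "\<exists>no. \<forall>n\<ge>no. norm (empirical_cdf X z \<omega> n s - F s) < r"
        by (simp add: eventually_sequentially)
    qed
  qed
qed

lemma empirical_cdf_bounds: "0 \<le> empirical_cdf X z \<omega> n s" "empirical_cdf X z \<omega> n s \<le> 1"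
proof -
  have "(\<Sum>k<n. indicator {..s} (X (z k) \<omega>)) \<le> (\<Sum>k<n. 1 :: real)"
    by (intro sum_mono) (simp add: indicator_def)
  \<comment> \<open>For \<open>n = 0\<close> the factor \<open>1 / real n\<close> is 0, so the bound
    holds there too.\<close>
  then show "empirical_cdf X z \<omega> n s \<le> 1"
    by (cases "n = 0") (simp_all add: empirical_cdf_def)
qed (simp add: empirical_cdf_def sum_nonneg)

lemma mono_empirical_cdf: "mono (empirical_cdf X z \<omega> n)"
  unfolding empirical_cdf_def by (intro monoI mult_left_mono sum_mono) (auto simp: indicator_def)

text \<open>The limits 0 and 1 at the two ends and the intermediate value theorem. The levels 0 and
  1 are excluded because they may fail to be attained.\<close>

lemma (in real_distribution) continuous_cdf_quantile:
  assumes "continuous_on UNIV (cdf M)" "0 < p" "p < 1"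
  shows "\<exists>x. cdf M x = p"
proof -
  have "\<forall>\<^sub>F x in at_bot. cdf M x < p"
    using cdf_lim_at_bot \<open>0 < p\<close> by (rule order_tendstoD)
  then obtain a where a: "cdf M a < p"
    by (auto simp: eventually_at_bot_linorder)
  have "\<forall>\<^sub>F x in at_top. p < cdf M x"
    using cdf_lim_at_top_prob \<open>p < 1\<close> by (rule order_tendstoD)
  then obtain b where b: "p < cdf M b"
    by (auto simp: eventually_at_top_linorder)
  have "a \<le> b"
    using cdf_nondecreasing[of b a] a b by linarith
  moreover have "continuous_on {a..b} (cdf M)"
    using assms(1) by (rule continuous_on_subset) simp
  ultimately show ?thesis
    using IVT'[of "cdf M" a p b] a b by (meson less_imp_le)
qed

theorem theorem1p8:
  fixes P :: "'w measure"
    and X :: "int ^ 'd \<Rightarrow> 'w \<Rightarrow> real"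
    and F :: "real \<Rightarrow> real"
    and z :: "nat \<Rightarrow> int ^ 'd"
  assumes "prob_space P"
    and "\<And>l. X l \<in> borel_measurable P"
    and "\<And>l. integrable P (\<lambda>\<omega>. (X l \<omega>)\<^sup>2)"
    and "\<And>l. integral\<^sup>L P (X l) = 0"
    and "strictly_stationary P X"
    and "pairwise_PQD P X"
    and "\<And>l. cdf (distr P borel (X l)) = F"
    and "(\<lambda>l. integral\<^sup>L P (\<lambda>\<omega>. X l \<omega> * X 0 \<omega>)) summable_on UNIV"
    and "summable (\<lambda>n. real (max_local_time z (Suc n)) / (real (Suc n))\<^sup>2)"
  shows "(\<forall>s. isCont F s \<longrightarrow>
            (AE \<omega> in P. (\<lambda>n. empirical_cdf X z \<omega> n s) \<longlonglongrightarrow> F s))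
       \<and> (continuous_on UNIV F \<longrightarrow>
            (AE \<omega> in P. uniform_limit UNIV (empirical_cdf X z \<omega>) F sequentially))"
proof -
  interpret prob_space P by fact
  note tendsto = PQD_field_empirical_cdf_tendsto[OF assms(2-9)]
  have "AE \<omega> in P. uniform_limit UNIV (empirical_cdf X z \<omega>) F sequentially"
    if cont: "continuous_on UNIV F"
  proof -
    interpret D: real_distribution "distr P borel (X 0)"
      using assms(2) by (rule real_distribution_distr)
    note F = assms(7)[of 0]
    \<comment> \<open>A choice of quantiles, meaningful for levels strictly between 0 and 1 and
      arbitrary elsewhere.\<close>
    define q where "q p = (SOME x. F x = p)" for p
    have q: "F (q p) = p" if "0 < p" "p < 1" for p
      unfolding q_def by (rule someI_ex, rule D.continuous_cdf_quantile[unfolded F, OF cont that])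
    \<comment> \<open>Every \<open>q p\<close> is a continuity point of \<open>F\<close>, and
      countably many levels leave a single exceptional null set.\<close>
    have "AE \<omega> in P. \<forall>p\<in>\<rat>. (\<lambda>n. empirical_cdf X z \<omega> n (q p)) \<longlonglongrightarrow> F (q p)"
      unfolding AE_ball_countable[OF countable_rat]
      using cont by (intro ballI tendsto) (simp add: continuous_on_eq_continuous_at)
    then show ?thesis
    proof eventually_elim
      case (elim \<omega>)
      show ?case
      proof (rule uniform_limit_of_quantiles[where q=q])
        show "0 \<le> F s" "F s \<le> 1" for s
          using D.cdf_nonneg[of s] D.cdf_bounded_prob[of s] unfolding F by simp_all
        show "mono F"
          using D.cdf_nondecreasing unfolding F by (rule monoI)
        show "F (q p) = p" if "p \<in> \<rat>" "0 < p" "p < 1" for p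
          using that by (intro q)
        show "(\<lambda>n. empirical_cdf X z \<omega> n (q p)) \<longlonglongrightarrow> F (q p)" if "p \<in> \<rat>" "0 < p" "p < 1" for p
          using elim that by blast
      qed (simp_all add: empirical_cdf_bounds mono_empirical_cdf)
    qed
  qed
  then show ?thesis using tendsto by blast
qed

end
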